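(* Let $\vec{X}=(X^1,X^2,X^3)\in\mathfrak{F}_\hbar^3$ be a noncommutative minimal surface for which $\partial(X^1-iX^2)\neq 0$. Then there exist r-holomorphic elements $f,g\in\mathfrak{F}_\hbar$ together with $x^1,x^2,x^3\in\mathbb{R}$ such that \begin{align*} X^1 &= x^1\mathbf{1}+\operatorname{Re}\int \tfrac12 f(\mathbf{1}-g^2)\,d\Lambda,\\ X^2 &= x^2\mathbf{1}+\operatorname{Re}\int \tfrac{i}{2} f(\mathbf{1}+g^2)\,d\Lambda,\\ X^3 &= x^3\mathbf{1}+\operatorname{Re}\int fg\,d\Lambda \end{align*} (where it is part of the assertion that the three integrands are integrable, and each integral denotes a primitive element of its integrand). Conversely, for any r-holomorphic $f,g\in\mathfrak{F}_\hbar$ such that $f(\mathbf{1}-g^2)$, $f(\mathbf{1}+g^2)$ and $fg$ are integrable (and any $x^1,x^2,x^3\in\mathbb{R}$ and any choice of the primitive elements), the three formulas above define a noncommutative minimal surface $\vec{X}=(X^1,X^2,X^3)$.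
   Context: Let $\hbar>0$ and let $\mathcal{A}_\hbar=\mathbb{C}\langle U,V\rangle/(UV-VU-i\hbar\mathbf{1})$ be the Weyl algebra (the unital associative complex algebra generated by $U,V$ with $[U,V]=i\hbar\mathbf{1}$). Let $\mathfrak{F}_\hbar$ be its skew field of fractions (Ore localization at all nonzero elements), whose elements can be written $AB^{-1}$ with $A,B\in\mathcal{A}_\hbar$, $B\ne0$. $\mathfrak{F}_\hbar$ is a $\ast$-algebra: $\ast$ is the conjugate-linear anti-multiplicative involution with $U^\ast=U$, $V^\ast=V$ (extended by $(A^{-1})^\ast=(A^\ast)^{-1}$). $A$ is hermitian if $A^\ast=A$; $\operatorname{Re}(A)=\frac12(A+A^\ast)$. Put $\Lambda=U+iV$ and, for $A\in\mathfrak{F}_\hbar$, $$\hat\partial_u(A)=\tfrac{1}{i\hbar}[A,V],\quad \hat\partial_v(A)=-\tfrac1{i\hbar}[A,U],\quad \partial(A)=\tfrac12(\hat\partial_u(A)-i\hat\partial_v(A)),\quad \bar\partial(A)=\tfrac12(\hat\partial_u(A)+i\hat\partial_v(A)).$$ $A\in\mathfrak{F}_\hbar$ is r-holomorphic if $\bar\partial A=0$. If $A,B$ are r-holomorphic and $\partial B=A$, then $B$ is called a primitive element of $A$; $\int A\,d\Lambda$ denotes an arbitrary primitive element of $A$; an r-holomorphic $A$ that has at least one primitive element is called integrable. The Laplace operator is $\Delta_0(A)=\hat\partial_u^2(A)+\hat\partial_v^2(A)$. For $\vec{X},\vec{Y}\in\mathfrak{F}_\hbar^n$ set $\langle\vec{X},\vec{Y}\rangle=\frac12\sum_{i=1}^n(X^iY^i+Y^iX^i)$;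 derivations act on $\mathfrak{F}_\hbar^n$ componentwise, and $\vec X$ is hermitian if every component is. A hermitian $\vec{X}\in\mathfrak{F}_\hbar^n$ is a noncommutative minimal surface if $\Delta_0(X^i)=0$ for $i=1,\dots,n$, and $\mathcal{E}=\mathcal{G}$, $\mathcal{F}=0$, where $\mathcal{E}=\langle\hat\partial_u\vec{X},\hat\partial_u\vec{X}\rangle$, $\mathcal{G}=\langle\hat\partial_v\vec{X},\hat\partial_v\vec{X}\rangle$, $\mathcal{F}=\langle\hat\partial_u\vec{X},\hat\partial_v\vec{X}\rangle$. *)

theory Defs
  imports "HOL-Analysis.Analysis" "HOL-Library.Poly_Mapping"
begin

datatype gen = GenU | GenV

datatype word = Word "gen list"

instantiation word :: monoid_add
begin

definition zero_word :: word where "0 = Word []"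

fun plus_word :: "word \<Rightarrow> word \<Rightarrow> word" where
  "Word xs + Word ys = Word (xs @ ys)"

instance
proof
  fix a b c :: word
  show "a + b + c = a + (b + c)" by (cases a; cases b; cases c) simp
  show "0 + a = a" by (cases a) (simp add: zero_word_def)
  show "a + 0 = a" by (cases a) (simp add: zero_word_def)
qed

end

text \<open>
  Words form an additively written monoid under concatenation, so that the convolution product of
  \<open>poly_mapping\<close> turns the finitely supported functions from words to complex numbers into
  the free unital complex algebra on \<open>U\<close> and \<open>V\<close>.
\<close>

type_synonym free_alg = "word \<Rightarrow>\<^sub>0 complex"

definition free_const :: "complex \<Rightarrow> free_alg" where
  "free_const c = Poly_Mapping.single 0 c"

definition free_U :: free_alg where
  "free_U = Poly_Mapping.single (Word [GenU]) 1"

definition free_V :: free_alg where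
  "free_V = Poly_Mapping.single (Word [GenV]) 1"

definition two_sided_ideal :: "'r::ring_1 set \<Rightarrow> bool" where
  "two_sided_ideal I \<longleftrightarrow>
     0 \<in> I \<and> (\<forall>x\<in>I. \<forall>y\<in>I. x + y \<in> I) \<and> (\<forall>x\<in>I. \<forall>r. r * x \<in> I \<and> x * r \<in> I)"

definition weyl_ideal :: "real \<Rightarrow> free_alg set" where
  "weyl_ideal hbar =
     two_sided_ideal hull {free_U * free_V - free_V * free_U - free_const (\<i> * of_real hbar)}"

text \<open>
  The Weyl algebra is the quotient of \<open>free_alg\<close> by \<open>weyl_ideal hbar\<close>. Types cannot depend on
  \<open>hbar\<close>, so its skew field of fractions is described by the defining properties of the Ore
  localization at the nonzero elements: a division ring \<open>'a\<close> and a unital ring homomorphism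
  \<open>ev\<close> from the free algebra with kernel \<open>weyl_ideal hbar\<close> (hence an embedding of the Weyl
  algebra) such that every element of \<open>'a\<close> is a fraction \<open>A B\<^sup>-\<^sup>1\<close> with \<open>A\<close>, \<open>B\<close> in the
  Weyl algebra and \<open>B\<close> nonzero. This determines \<open>('a, ev)\<close> up to unique isomorphism.
  The complex scalars of \<open>'a\<close> are the images of the constants of the free algebra.
\<close>

locale weyl_skew_field =
  fixes hbar :: real and ev :: "free_alg \<Rightarrow> 'a::division_ring"
  assumes hbar_pos: "hbar > 0"
    and ev_one: "ev 1 = 1"
    and ev_add: "ev (p + q) = ev p + ev q"
    and ev_mult: "ev (p * q) = ev p * ev q"
    and ev_kernel: "{p. ev p = 0} = weyl_ideal hbar"
    and fractions: "\<exists>p q. ev q \<noteq> 0 \<and> A = ev p * inverse (ev q)"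

definition scalar :: "(free_alg \<Rightarrow> 'a::division_ring) \<Rightarrow> complex \<Rightarrow> 'a" where
  "scalar ev c = ev (free_const c)"

definition elt_U :: "(free_alg \<Rightarrow> 'a::division_ring) \<Rightarrow> 'a" where
  "elt_U ev = ev free_U"

definition elt_V :: "(free_alg \<Rightarrow> 'a::division_ring) \<Rightarrow> 'a" where
  "elt_V ev = ev free_V"

text \<open>
  The axioms determine \<open>star\<close> uniquely; \<open>star (inverse A) = inverse (star A)\<close> for nonzero
  \<open>A\<close> follows from anti-multiplicativity, and conjugate-linearity from additivity,
  anti-multiplicativity and the values on scalars (which are central).
\<close>

locale weyl_star_skew_field = weyl_skew_field hbar ev
  for hbar :: real and ev :: "free_alg \<Rightarrow> 'a::division_ring" +
  fixes star :: "'a \<Rightarrow> 'a"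
  assumes star_add: "star (A + B) = star A + star B"
    and star_mult: "star (A * B) = star B * star A"
    and star_star: "star (star A) = A"
    and star_scalar: "star (scalar ev c) = scalar ev (cnj c)"
    and star_U: "star (elt_U ev) = elt_U ev"
    and star_V: "star (elt_V ev) = elt_V ev"

definition hermitian :: "('a \<Rightarrow> 'a) \<Rightarrow> 'a \<Rightarrow> bool" where
  "hermitian star A \<longleftrightarrow> star A = A"

definition re_part ::
  "(free_alg \<Rightarrow> 'a::division_ring) \<Rightarrow> ('a \<Rightarrow> 'a) \<Rightarrow> 'a \<Rightarrow> 'a" where
  "re_part ev star A = scalar ev (1/2) * (A + star A)"

definition commutator :: "'a::ring \<Rightarrow> 'a \<Rightarrow> 'a" where
  "commutator A B = A * B - B * A"

definition deriv_u :: "real \<Rightarrow> (free_alg \<Rightarrow> 'a::division_ring) \<Rightarrow> 'a \<Rightarrow> 'a" where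
  "deriv_u hbar ev A = scalar ev (1 / (\<i> * of_real hbar)) * commutator A (elt_V ev)"

definition deriv_v :: "real \<Rightarrow> (free_alg \<Rightarrow> 'a::division_ring) \<Rightarrow> 'a \<Rightarrow> 'a" where
  "deriv_v hbar ev A = - (scalar ev (1 / (\<i> * of_real hbar)) * commutator A (elt_U ev))"

definition del :: "real \<Rightarrow> (free_alg \<Rightarrow> 'a::division_ring) \<Rightarrow> 'a \<Rightarrow> 'a" where
  "del hbar ev A = scalar ev (1/2) * (deriv_u hbar ev A - scalar ev \<i> * deriv_v hbar ev A)"

definition delbar :: "real \<Rightarrow> (free_alg \<Rightarrow> 'a::division_ring) \<Rightarrow> 'a \<Rightarrow> 'a" where
  "delbar hbar ev A = scalar ev (1/2) * (deriv_u hbar ev A + scalar ev \<i> * deriv_v hbar ev A)"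

definition laplace :: "real \<Rightarrow> (free_alg \<Rightarrow> 'a::division_ring) \<Rightarrow> 'a \<Rightarrow> 'a" where
  "laplace hbar ev A =
     deriv_u hbar ev (deriv_u hbar ev A) + deriv_v hbar ev (deriv_v hbar ev A)"

definition r_holomorphic :: "real \<Rightarrow> (free_alg \<Rightarrow> 'a::division_ring) \<Rightarrow> 'a \<Rightarrow> bool" where
  "r_holomorphic hbar ev A \<longleftrightarrow> delbar hbar ev A = 0"

text \<open>\<open>is_primitive hbar ev A B\<close> means that \<open>B\<close> is a possible value of \<open>\<integral> A d\<Lambda>\<close>.\<close>

definition is_primitive ::
  "real \<Rightarrow> (free_alg \<Rightarrow> 'a::division_ring) \<Rightarrow> 'a \<Rightarrow> 'a \<Rightarrow> bool" where
  "is_primitive hbar ev A B \<longleftrightarrow>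
     r_holomorphic hbar ev A \<and> r_holomorphic hbar ev B \<and> del hbar ev B = A"

definition integrable_elt :: "real \<Rightarrow> (free_alg \<Rightarrow> 'a::division_ring) \<Rightarrow> 'a \<Rightarrow> bool" where
  "integrable_elt hbar ev A \<longleftrightarrow>
     r_holomorphic hbar ev A \<and> (\<exists>B. is_primitive hbar ev A B)"

definition vec_form ::
  "(free_alg \<Rightarrow> 'a::division_ring) \<Rightarrow> 'a ^ 'n \<Rightarrow> 'a ^ 'n \<Rightarrow> 'a" where
  "vec_form ev X Y = scalar ev (1/2) * (\<Sum>i\<in>UNIV. X $ i * Y $ i + Y $ i * X $ i)"

definition vec_u :: "real \<Rightarrow> (free_alg \<Rightarrow> 'a::division_ring) \<Rightarrow> 'a ^ 'n \<Rightarrow> 'a ^ 'n" where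
  "vec_u hbar ev X = (\<chi> i. deriv_u hbar ev (X $ i))"

definition vec_v :: "real \<Rightarrow> (free_alg \<Rightarrow> 'a::division_ring) \<Rightarrow> 'a ^ 'n \<Rightarrow> 'a ^ 'n" where
  "vec_v hbar ev X = (\<chi> i. deriv_v hbar ev (X $ i))"

definition nc_minimal_surface ::
  "real \<Rightarrow> (free_alg \<Rightarrow> 'a::division_ring) \<Rightarrow> ('a \<Rightarrow> 'a) \<Rightarrow> 'a ^ 'n \<Rightarrow> bool" where
  "nc_minimal_surface hbar ev star X \<longleftrightarrow>
     (\<forall>i. hermitian star (X $ i)) \<and>
     (\<forall>i. laplace hbar ev (X $ i) = 0) \<and>
     vec_form ev (vec_u hbar ev X) (vec_u hbar ev X)
       = vec_form ev (vec_v hbar ev X) (vec_v hbar ev X) \<and>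
     vec_form ev (vec_u hbar ev X) (vec_v hbar ev X) = 0"

end

theory Submission
  imports Defs
begin

text \<open>
  Both \<open>\<partial>\<close> and \<open>\<partial>\<close>-bar are inner derivations, by multiples of \<open>\<Lambda>\<^sup>*\<close> and \<open>\<Lambda>\<close>, and they act on the
  normally ordered polynomials in \<open>\<Lambda>\<close> and \<open>\<Lambda>\<^sup>*\<close> like partial derivatives. Applying \<open>\<partial>\<close>-bar to
  \<open>x B = A\<close> until \<open>B\<close> is constant shows that every r-holomorphic \<open>x\<close> is a fraction of polynomials in
  \<open>\<Lambda>\<close>. Hence r-holomorphic elements commute with each other, and elements killed by both derivations
  are scalars. For a minimal surface the elements \<open>2 \<partial> X\<^sup>i\<close> are r-holomorphic with squares summing to
  0, so the classical choice of \<open>f\<close> and \<open>g\<close> works. The noncommutative point is that \<open>2 \<partial> X\<^sup>i\<close> has an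
  r-holomorphic primitive: a denominator \<open>B\<close> of \<open>X\<^sup>i\<close>, monic of minimal degree in \<open>\<Lambda>\<^sup>*\<close>, satisfies
  \<open>\<partial> B = 0\<close>, and the primitive is then read off from the coefficients of the polynomial \<open>X\<^sup>i B\<close>.
\<close>

section \<open>Locally nilpotent derivations\<close>

text \<open>Horner form keeps every coefficient to the left of the powers of \<open>t\<close>, since
  coefficients need not commute with \<open>t\<close>.\<close>

inductive_set polys :: "'a::ring_1 set \<Rightarrow> 'a \<Rightarrow> 'a set" for S t where
  const: "s \<in> S \<Longrightarrow> s \<in> polys S t"
| horner: "s \<in> S \<Longrightarrow> x \<in> polys S t \<Longrightarrow> s + x * t \<in> polys S t"

lemma polys_add:
  assumes S: "\<And>r s. r \<in> S \<Longrightarrow> s \<in> S \<Longrightarrow> r + s \<in> S"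
    and "x \<in> polys S t" "y \<in> polys S t"
  shows "x + y \<in> polys S t"
  using assms(2,3)
proof (induction x arbitrary: y)
  case (const r)
  from const(2) show ?case
  proof cases
    case (horner s z)
    then have "r + y = (r + s) + z * t" by (simp add: algebra_simps)
    then show ?thesis using S const horner by (metis polys.horner)
  qed (use S const in \<open>auto intro: polys.const\<close>)
next
  case (horner r x)
  from horner(4) show ?case
  proof cases
    case const
    have "(r + x * t) + y = (r + y) + x * t" by (simp add: algebra_simps)
    then show ?thesis using S const horner by (metis polys.horner)
  next
    case (horner s z)
    then have "(r + x * t) + y = (r + s) + (x + z) * t" by (simp add: algebra_simps)
    then show ?thesis using S \<open>r \<in> S\<close> horner(2,3) horner.IH
      by (metis polys.horner)
  qed
qed

lemma polys_mult_left:
  assumes S: "\<And>s. s \<in> S \<Longrightarrow> c * s \<in> S" and "x \<in> polys S t"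
  shows "c * x \<in> polys S t"
  using assms(2)
proof (induction x)
  case (horner s x)
  have "c * (s + x * t) = c * s + (c * x) * t" by (simp add: algebra_simps)
  then show ?case using S horner by (metis polys.horner)
qed (use S in \<open>auto intro: polys.const\<close>)

lemma polys_mult_var:
  assumes "0 \<in> S" "x \<in> polys S t"
  shows "x * t \<in> polys S t"
  using polys.horner[OF assms] by simp

locale derivation =
  fixes d :: "'a::ring_1 \<Rightarrow> 'a"
  assumes add: "d (x + y) = d x + d y"
    and leibniz: "d (x * y) = d x * y + x * d y"
begin

lemma zero [simp]: "d 0 = 0"
  using add[of 0 0] by simp

lemma minus: "d (- x) = - d x"
  using add[of x "- x"] by (simp add: eq_neg_iff_add_eq_0 add.commute)

lemma diff: "d (x - y) = d x - d y"
  using add[of x "- y"] by (simp add: minus)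

lemma one [simp]: "d 1 = 0"
  using leibniz[of 1 1] by simp

lemma of_nat [simp]: "d (of_nat n) = 0"
  by (induction n) (simp_all add: add)

lemma iter_zero [simp]: "(d ^^ n) 0 = 0"
  by (induction n) simp_all

lemma iter_add: "(d ^^ n) (x + y) = (d ^^ n) x + (d ^^ n) y"
  by (induction n) (simp_all add: add)

lemma iter_diff: "(d ^^ n) (x - y) = (d ^^ n) x - (d ^^ n) y"
  by (induction n) (simp_all add: diff)

lemma iter_mult_const:
  assumes "d c = 0"
  shows "(d ^^ n) (x * c) = (d ^^ n) x * c" "(d ^^ n) (c * x) = c * (d ^^ n) x"
  by (induction n) (simp_all add: leibniz assms)

lemma iter_zero_mono:
  assumes "(d ^^ m) x = 0" "m \<le> n"
  shows "(d ^^ n) x = 0"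
proof -
  have "(d ^^ n) x = (d ^^ (n - m)) ((d ^^ m) x)"
    using assms(2) by (metis funpow_add comp_apply le_add_diff_inverse2)
  then show ?thesis using assms(1) by simp
qed

lemma last_nonzero:
  assumes "(d ^^ n) x = 0" "x \<noteq> 0"
  obtains k where "(d ^^ k) x \<noteq> 0" "d ((d ^^ k) x) = 0"
proof -
  define m where "m = (LEAST n. (d ^^ n) x = 0)"
  have m: "(d ^^ m) x = 0" unfolding m_def by (rule LeastI[of _ n]) (rule assms)
  with assms obtain k where k: "m = Suc k" by (cases m) auto
  have "(d ^^ k) x \<noteq> 0" using not_less_Least[of k "\<lambda>n. (d ^^ n) x = 0"] k
    unfolding m_def by auto
  with m k that show ?thesis by simp
qed

end

section \<open>Constants of a derivation with a slice\<close>

locale slice_derivation = derivation d for d :: "'a::{ring_1, ring_no_zero_divisors} \<Rightarrow> 'a" +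
  fixes t :: 'a
  assumes slice: "d t = 1"
    and of_nat_nonzero: "of_nat (Suc n) \<noteq> (0::'a)"
begin

text \<open>The higher Leibniz formula stops after two terms, because
  \<open>d (d t) = 0\<close>.\<close>

lemma iter_mult_slice:
  "(d ^^ Suc n) (x * t) = (d ^^ Suc n) x * t + of_nat (Suc n) * (d ^^ n) x"
proof (induction n)
  case 0
  then show ?case by (simp add: leibniz slice)
next
  case (Suc n)
  have "(d ^^ Suc (Suc n)) (x * t) = d ((d ^^ Suc n) x * t + of_nat (Suc n) * (d ^^ n) x)"
    using Suc by simp
  then show ?case by (simp add: add leibniz slice algebra_simps)
qed

lemma nilpotent_mult_slice:
  assumes "(d ^^ n) x = 0"
  shows "(d ^^ Suc n) (x * t) = 0"
  using assms by (simp only: iter_mult_slice) simp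

text \<open>On degree-\<open>n\<close> polynomials the operator below multiplies the leading coefficient by
  \<open>k + 1 + n\<close>.\<close>

lemma euler_eq_zero:
  assumes "(d ^^ n) x = 0" "of_nat (Suc k) * x + d x * t = 0"
  shows "x = 0"
  using assms
proof (induction n arbitrary: x k)
  case (Suc n)
  have "d (of_nat (Suc k) * x + d x * t) = 0" using Suc.prems(2) by simp
  \<comment> \<open>Differentiating gives the same equation for \<open>d x\<close> with
    \<open>k\<close> raised by 1, which is why the induction keeps \<open>k\<close> general.\<close>
  then have "of_nat (Suc (Suc k)) * d x + d (d x) * t = 0"
    by (simp add: add leibniz slice algebra_simps)
  with Suc.IH[of "d x" "Suc k"] Suc.prems(1) have "d x = 0"
    by (simp add: funpow_swap1)
  with Suc.prems(2) show ?case using of_nat_nonzero[of k] by (simp del: of_nat_Suc)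
qed simp

context
  fixes S
  assumes ker: "\<And>s. s \<in> S \<Longrightarrow> d s = 0" and zero_in: "0 \<in> S"
    and add_in: "\<And>r s. r \<in> S \<Longrightarrow> s \<in> S \<Longrightarrow> r + s \<in> S"
begin

lemma polys_closed: "x \<in> polys S t \<Longrightarrow> d x \<in> polys S t"
proof (induction rule: polys.induct)
  case (horner s x)
  have "d (s + x * t) = d x * t + x" using horner by (simp add: add leibniz slice ker)
  moreover have "d x * t \<in> polys S t" by (rule polys_mult_var) (use horner zero_in in auto)
  ultimately show ?case using polys_add[OF add_in] horner by auto
qed (auto simp: ker zero_in intro: polys.const)

lemma polys_iter_closed: "x \<in> polys S t \<Longrightarrow> (d ^^ n) x \<in> polys S t"
  by (induction n) (auto intro: polys_closed)

lemma polys_nilpotent: "x \<in> polys S t \<Longrightarrow> \<exists>n. (d ^^ n) x = 0"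
proof (induction rule: polys.induct)
  case (const s)
  then have "(d ^^ 1) s = 0" by (simp add: ker)
  then show ?case by blast
next
  case (horner s x)
  then obtain n where "(d ^^ n) x = 0" by blast
  then have "(d ^^ Suc n) (x * t) = 0" by (rule nilpotent_mult_slice)
  moreover have "(d ^^ Suc n) s = 0" using horner by (simp add: funpow_swap1 ker)
  ultimately show ?case by (metis iter_add add_0)
qed

lemma polys_ker:
  assumes "x \<in> polys S t" "d x = 0"
  shows "x \<in> S"
  using assms(1)
proof cases
  case (horner s y)
  obtain n where "(d ^^ n) y = 0" using polys_nilpotent horner by blast
  \<comment> \<open>This is \<open>d x = 0\<close> for \<open>x = s + y * t\<close>; the case
    \<open>k = 0\<close> of \<open>euler_eq_zero\<close> then forces \<open>y = 0\<close>.\<close>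
  moreover have "of_nat (Suc 0) * y + d y * t = 0"
    using assms(2) horner by (simp add: add leibniz slice ker algebra_simps)
  ultimately have "y = 0" by (rule euler_eq_zero)
  with horner show ?thesis by simp
qed

text \<open>Differentiate \<open>x * b = a\<close> until \<open>b\<close> becomes constant.\<close>

lemma fraction_ker:
  assumes "d x = 0" "x * b = a" "b \<noteq> 0" "a \<in> polys S t" "b \<in> polys S t"
  obtains a' b' where "a' \<in> S" "b' \<in> S" "b' \<noteq> 0" "x * b' = a'"
proof -
  obtain n where "(d ^^ n) b = 0" using polys_nilpotent assms by blast
  then obtain k where k: "(d ^^ k) b \<noteq> 0" "d ((d ^^ k) b) = 0"
    using assms last_nonzero by metis
  have eq: "x * (d ^^ k) b = (d ^^ k) a"
    using iter_mult_const(2)[OF assms(1)] assms(2) by metis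
  have "d ((d ^^ k) a) = 0" unfolding eq[symmetric] using k assms(1) by (simp add: leibniz)
  then show ?thesis using that k eq assms(4,5) by (meson polys_iter_closed polys_ker)
qed

end

end


section \<open>The Weyl skew field\<close>

lemma derivation_commutator:
  assumes "\<And>x :: 'a::ring_1. c * x = x * c"
  shows "derivation (\<lambda>A. c * commutator A L)"
proof
  fix x y :: 'a
  show "c * commutator (x + y) L = c * commutator x L + c * commutator y L"
    by (simp add: commutator_def algebra_simps)
  have "x * (c * commutator y L) = c * (x * commutator y L)"
    using assms by (metis mult.assoc)
  then show "c * commutator (x * y) L = c * commutator x L * y + x * (c * commutator y L)"
    by (simp add: commutator_def algebra_simps)
qed

context weyl_skew_field
begin

abbreviation sc :: "complex \<Rightarrow> 'a" where "sc \<equiv> scalar ev"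
abbreviation D :: "'a \<Rightarrow> 'a" where "D \<equiv> del hbar ev"
abbreviation Db :: "'a \<Rightarrow> 'a" where "Db \<equiv> delbar hbar ev"

definition Lam :: 'a where "Lam = elt_U ev + sc \<i> * elt_V ev"
text \<open>The adjoint of \<open>Lam\<close>, written out because this locale has no
  involution.\<close>

definition Lams :: 'a where "Lams = elt_U ev - sc \<i> * elt_V ev"

section \<open>Scalars and their centrality\<close>

lemma ev_0: "ev 0 = 0"
  using ev_add[of 0 0] by simp

lemma ev_diff: "ev (p - q) = ev p - ev q"
  using ev_add[of "p - q" q] by (simp add: algebra_simps)

lemma sc_add: "sc (a + b) = sc a + sc b"
  by (simp add: scalar_def free_const_def single_add ev_add)

lemma sc_mult: "sc (a * b) = sc a * sc b"
  unfolding scalar_def ev_mult[symmetric] by (simp add: free_const_def mult_single)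

lemma sc_1 [simp]: "sc 1 = 1"
  by (simp add: scalar_def free_const_def ev_one)

lemma sc_0 [simp]: "sc 0 = 0"
  by (simp add: scalar_def free_const_def ev_0)

lemma sc_minus: "sc (- a) = - sc a"
  using sc_add[of a "- a"] by (simp add: eq_neg_iff_add_eq_0 add.commute)

lemma sc_of_nat: "sc (of_nat n) = of_nat n"
  by (induction n) (simp_all add: sc_add)

lemma sc_numeral: "sc (numeral n) = numeral n"
  using sc_of_nat[of "numeral n"] by simp

lemma sc_eq_0_iff [simp]: "sc a = 0 \<longleftrightarrow> a = 0"
proof
  assume "sc a = 0"
  then show "a = 0" using sc_mult[of a "inverse a"] by (cases "a = 0") auto
qed simp

lemma sc_inj: "sc a = sc b \<Longrightarrow> a = b"
  using sc_add[of "a - b" b] sc_eq_0_iff[of "a - b"] by simp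

lemma of_nat_nz: "of_nat (Suc n) \<noteq> (0::'a)"
  using sc_eq_0_iff[of "of_nat (Suc n)"] sc_of_nat[of "Suc n"]
  by (simp del: of_nat_Suc)

text \<open>Elements of the Weyl algebra are sums of words with scalar coefficients. Words grow on
  the right, where \<open>polys\<close> also puts its variable.\<close>

lemma ev_induct:
  assumes const: "\<And>c. P (sc c)"
    and add: "\<And>x y. P x \<Longrightarrow> P y \<Longrightarrow> P (x + y)"
    and U: "\<And>x. P x \<Longrightarrow> P (x * elt_U ev)"
    and V: "\<And>x. P x \<Longrightarrow> P (x * elt_V ev)"
  shows "P (ev p)"
proof (induction p rule: update_induct)
  case const
  show ?case using assms(1)[of 0] by (simp add: ev_0)
next
  case (update f w c)
  have "P (ev (Poly_Mapping.single (Word xs) c))" for xs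
  proof (induction xs rule: rev_induct)
    case Nil
    then show ?case
      using assms(1)[of c] by (simp add: scalar_def free_const_def zero_word_def)
  next
    case (snoc g xs)
    have "Poly_Mapping.single (Word (xs @ [g])) c
        = Poly_Mapping.single (Word xs) c * Poly_Mapping.single (Word [g]) 1"
      by (simp add: mult_single)
    then show ?case
      using U[OF snoc] V[OF snoc]
      by (cases g) (simp_all add: ev_mult elt_U_def elt_V_def free_U_def free_V_def)
  qed
  then have "P (ev (Poly_Mapping.single w c))" by (cases w) simp
  moreover have "Poly_Mapping.update w c f = f + Poly_Mapping.single w c"
    using update(1)
    by (intro poly_mapping_eqI) (auto simp: lookup_update lookup_add lookup_single in_keys_iff)
  ultimately show ?case using update add by (simp add: ev_add)
qed

text \<open>Commuting with both generators gives centrality in the Weyl algebra; what commutes with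
  a denominator commutes with its inverse, hence with every fraction.\<close>

lemma sc_central: "sc c * x = x * sc c"
proof -
  have *: "sc c * ev p = ev p * sc c" for p
  proof (induction rule: ev_induct)
    case (1 d)
    then show ?case by (metis sc_mult mult.commute)
  next
    case (2 x y)
    then show ?case by (simp add: algebra_simps)
  next
    case (3 x)
    have "sc c * elt_U ev = elt_U ev * sc c"
      unfolding scalar_def elt_U_def ev_mult[symmetric]
      by (simp add: free_const_def free_U_def mult_single)
    then show ?case using 3 by (metis mult.assoc)
  next
    case (4 x)
    have "sc c * elt_V ev = elt_V ev * sc c"
      unfolding scalar_def elt_V_def ev_mult[symmetric]
      by (simp add: free_const_def free_V_def mult_single)
    then show ?case using 4 by (metis mult.assoc)
  qed
  obtain p q where x: "ev q \<noteq> 0" "x = ev p * inverse (ev q)" using fractions by blast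
  have "inverse (ev q) * sc c = inverse (ev q) * (sc c * ev q) * inverse (ev q)"
    using x(1) by (simp add: mult.assoc)
  also have "\<dots> = inverse (ev q) * (ev q * sc c) * inverse (ev q)"
    by (simp only: *)
  also have "\<dots> = sc c * inverse (ev q)"
    using x(1) by (simp add: mult.assoc[symmetric])
  finally have "sc c * inverse (ev q) = inverse (ev q) * sc c" ..
  then show ?thesis using * x(2) by (metis mult.assoc)
qed

lemma sc_left_commute: "x * (sc c * y) = sc c * (x * y)"
  by (metis mult.assoc sc_central)

text \<open>The guards keep the simplifier from swapping two scalars forever.\<close>

lemma sc_move:
  "NO_MATCH (scalar ev d) x \<Longrightarrow> x * sc c = sc c * x"
  "NO_MATCH (scalar ev d) x \<Longrightarrow> x * (sc c * y) = sc c * (x * y)"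
  "sc a * sc b = sc (a * b)" "sc a * (sc b * y) = sc (a * b) * y"
  by (rule sc_central[symmetric] sc_left_commute sc_mult[symmetric] | simp add: sc_mult mult.assoc)+

section \<open>The two derivations as commutators with \<open>Lams\<close> and
  \<open>Lam\<close>\<close>

lemma UV: "elt_U ev * elt_V ev = elt_V ev * elt_U ev + sc (\<i> * of_real hbar)"
proof -
  have "free_U * free_V - free_V * free_U - free_const (\<i> * of_real hbar) \<in> {p. ev p = 0}"
    unfolding ev_kernel weyl_ideal_def by (rule hull_inc) simp
  then show ?thesis
    by (simp add: ev_diff ev_add ev_mult scalar_def elt_U_def elt_V_def algebra_simps)
qed

text \<open>That this is a nonzero scalar makes \<open>Lam\<close> a variable for \<open>D\<close>
  and \<open>Lams\<close> a variable for \<open>Db\<close>.\<close>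

lemma commutator_Lam: "commutator Lam Lams = sc (2 * of_real hbar)"
proof -
  have "commutator Lam Lams = - (2 * sc \<i> * (elt_U ev * elt_V ev - elt_V ev * elt_U ev))"
    by (simp add: commutator_def Lam_def Lams_def algebra_simps sc_move mult_2)
  also have "\<dots> = sc (- (2 * \<i> * (\<i> * of_real hbar)))"
    by (simp only: UV add_diff_cancel_left' sc_numeral[symmetric] sc_minus sc_move(3) mult.assoc)
  also have "- (2 * \<i> * (\<i> * complex_of_real hbar)) = 2 * of_real hbar" by simp
  finally show ?thesis .
qed

lemma hbar_nz: "hbar \<noteq> 0"
  using hbar_pos by simp

lemma D_eq: "D A = sc (1 / (2 * of_real hbar)) * commutator A Lams"
proof -
  define k where "k = sc (1 / (\<i> * of_real hbar))"
  have "D A = sc (1/2) * k * (commutator A (elt_V ev) + sc \<i> * commutator A (elt_U ev))"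
    by (simp add: del_def deriv_u_def deriv_v_def k_def algebra_simps sc_move)
  also have "commutator A (elt_V ev) + sc \<i> * commutator A (elt_U ev) = sc \<i> * commutator A Lams"
  proof -
    have "sc \<i> * (sc \<i> * x) = - x" for x
      by (simp add: mult.assoc[symmetric] sc_mult[symmetric] sc_minus)
    then show ?thesis
      by (simp add: commutator_def Lams_def algebra_simps sc_move)
  qed
  also have "sc (1/2) * k * (sc \<i> * commutator A Lams)
      = sc (1/2 * (1 / (\<i> * of_real hbar)) * \<i>) * commutator A Lams"
    by (simp only: sc_mult k_def mult.assoc)
  also have "1/2 * (1 / (\<i> * of_real hbar)) * \<i> = 1 / (2 * complex_of_real hbar)"
    using hbar_nz by (simp add: field_simps)
  finally show ?thesis .
qed

lemma Db_eq: "Db A = sc (- 1 / (2 * of_real hbar)) * commutator A Lam"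
proof -
  define k where "k = sc (1 / (\<i> * of_real hbar))"
  have "Db A = sc (1/2) * k * (commutator A (elt_V ev) - sc \<i> * commutator A (elt_U ev))"
    by (simp add: delbar_def deriv_u_def deriv_v_def k_def algebra_simps sc_move)
  also have "commutator A (elt_V ev) - sc \<i> * commutator A (elt_U ev) = sc (- \<i>) * commutator A Lam"
  proof -
    have "sc \<i> * (sc \<i> * x) = - x" for x
      by (simp add: mult.assoc[symmetric] sc_mult[symmetric] sc_minus)
    then show ?thesis
      by (simp add: commutator_def Lam_def algebra_simps sc_move sc_minus)
  qed
  also have "sc (1/2) * k * (sc (- \<i>) * commutator A Lam)
      = sc (1/2 * (1 / (\<i> * of_real hbar)) * (- \<i>)) * commutator A Lam"
    by (simp only: sc_mult k_def mult.assoc)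
  also have "1/2 * (1 / (\<i> * of_real hbar)) * (- \<i>) = - 1 / (2 * complex_of_real hbar)"
    using hbar_nz by (simp add: field_simps)
  finally show ?thesis .
qed

sublocale D: derivation D
  unfolding D_eq by (rule derivation_commutator) (rule sc_central)

sublocale Db: derivation Db
  unfolding Db_eq by (rule derivation_commutator) (rule sc_central)

lemma D_sc [simp]: "D (sc c) = 0"
  by (simp add: D_eq commutator_def sc_move)

lemma Db_sc [simp]: "Db (sc c) = 0"
  by (simp add: Db_eq commutator_def sc_move)

lemma D_sc_mult: "D (sc c * x) = sc c * D x"
  by (simp add: D.leibniz)

lemma Db_sc_mult: "Db (sc c * x) = sc c * Db x"
  by (simp add: Db.leibniz)

lemma Db_inverse:
  assumes "Db x = 0"
  shows "Db (inverse x) = 0"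
proof (cases "x = 0")
  case False
  have "x * Db (inverse x) = Db (x * inverse x)"
    unfolding Db.leibniz assms by simp
  also have "\<dots> = 0" using False by simp
  finally show ?thesis using False by simp
qed simp

lemma D_Lams [simp]: "D Lams = 0"
  by (simp add: D_eq commutator_def)

lemma Db_Lam [simp]: "Db Lam = 0"
  by (simp add: Db_eq commutator_def)

lemma D_Lam [simp]: "D Lam = 1"
  using hbar_nz by (simp add: D_eq commutator_Lam sc_mult[symmetric])

lemma Db_Lams [simp]: "Db Lams = 1"
proof -
  have "commutator Lams Lam = sc (- (2 * of_real hbar))"
    using commutator_Lam by (simp add: commutator_def sc_minus algebra_simps)
  then show ?thesis using hbar_nz by (simp add: Db_eq sc_mult[symmetric])
qed

text \<open>By the Jacobi identity the two orders differ by a commutator with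
  \<open>commutator Lam Lams\<close>, which is central.\<close>

lemma D_Db: "D (Db x) = Db (D x)"
proof -
  have "commutator (commutator x Lam) Lams - commutator (commutator x Lams) Lam
      = commutator x (commutator Lam Lams)"
    by (simp add: commutator_def algebra_simps)
  also have "\<dots> = 0" by (simp add: commutator_Lam) (simp add: commutator_def sc_move)
  finally have *: "commutator (commutator x Lam) Lams = commutator (commutator x Lams) Lam" by simp
  have **: "commutator (sc a * y) z = sc a * commutator y z" for a y z
    by (simp add: commutator_def algebra_simps sc_move)
  show ?thesis
    unfolding D_eq Db_eq ** * by (rule sc_left_commute)
qed

lemma D_iter_Db: "D ((Db ^^ n) x) = (Db ^^ n) (D x)"
  by (induction n) (simp_all add: D_Db)

sublocale D: slice_derivation D Lam
  by unfold_locales (simp_all add: of_nat_nz del: of_nat_Suc)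

sublocale Db: slice_derivation Db Lams
  by unfold_locales (simp_all add: of_nat_nz del: of_nat_Suc)

lemma Db_0_iff: "Db x = 0 \<longleftrightarrow> x * Lam = Lam * x"
  using hbar_nz by (simp add: Db_eq commutator_def)

section \<open>Normal ordering\<close>

abbreviation scalars :: "'a set" where "scalars \<equiv> range sc"
abbreviation holo_polys :: "'a set" where "holo_polys \<equiv> polys scalars Lam"
text \<open>Two layers, so that the results on slices apply first to \<open>Db\<close>, with
  constants \<open>holo_polys\<close>, and then to \<open>D\<close>, with constants
  \<open>scalars\<close>.\<close>

abbreviation normal_ordered :: "'a set" where "normal_ordered \<equiv> polys holo_polys Lams"

lemma scalars_0: "0 \<in> scalars"
  by (metis rangeI sc_0)

lemma scalars_add: "r \<in> scalars \<Longrightarrow> s \<in> scalars \<Longrightarrow> r + s \<in> scalars"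
  by (auto simp: sc_add[symmetric])

lemma scalars_mult: "s \<in> scalars \<Longrightarrow> sc c * s \<in> scalars"
  by (auto simp: sc_mult[symmetric])

lemma holo_polys_add: "x \<in> holo_polys \<Longrightarrow> y \<in> holo_polys \<Longrightarrow> x + y \<in> holo_polys"
  using polys_add scalars_add by blast

lemma normal_ordered_add:
  "x \<in> normal_ordered \<Longrightarrow> y \<in> normal_ordered \<Longrightarrow> x + y \<in> normal_ordered"
  using polys_add holo_polys_add by blast

lemma normal_ordered_mult: "x \<in> normal_ordered \<Longrightarrow> sc c * x \<in> normal_ordered"
  by (rule polys_mult_left, rule polys_mult_left, rule scalars_mult)

lemma holo_polys_0: "0 \<in> holo_polys"
  by (rule polys.const) (rule scalars_0)

lemma Db_holo_polys: "x \<in> holo_polys \<Longrightarrow> Db x = 0"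
  by (induction rule: polys.induct) (auto simp: Db.add Db.leibniz)

text \<open>The left factor is built from scalars and \<open>Lam\<close>, and
  \<open>Db y = 0\<close> means that \<open>y\<close> commutes with \<open>Lam\<close>.\<close>

lemma holo_polys_commute: "x \<in> holo_polys \<Longrightarrow> Db y = 0 \<Longrightarrow> x * y = y * x"
proof (induction rule: polys.induct)
  case (const s)
  then show ?case by (auto simp: sc_move)
next
  case (horner s x)
  have "x * Lam * y = x * (Lam * y)" by (rule mult.assoc)
  also have "\<dots> = x * (y * Lam)" using horner by (simp add: Db_0_iff)
  also have "\<dots> = (x * y) * Lam" by (rule mult.assoc[symmetric])
  also have "\<dots> = y * (x * Lam)" using horner by (simp only: mult.assoc)
  finally show ?case using horner(1) by (auto simp: distrib_left distrib_right sc_move)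
qed

lemma normal_ordered_mult_Lam: "x \<in> normal_ordered \<Longrightarrow> x * Lam \<in> normal_ordered"
proof (induction rule: polys.induct)
  case (const s)
  then show ?case by (rule polys.const[OF polys_mult_var[OF scalars_0]])
next
  case (horner s x)
  \<comment> \<open>Moving \<open>Lam\<close> to the left past \<open>Lams\<close> costs a scalar,
    so the correction is a scalar multiple of \<open>x\<close>.\<close>
  have "Lams * Lam = Lam * Lams + sc (- (2 * of_real hbar))"
    using commutator_Lam by (simp add: commutator_def sc_minus algebra_simps)
  then have "(s + x * Lams) * Lam = (s * Lam + (x * Lam) * Lams) + sc (- (2 * of_real hbar)) * x"
    by (simp add: algebra_simps) (simp add: sc_move sc_minus)
  moreover have "s * Lam + (x * Lam) * Lams \<in> normal_ordered"
    using horner by (intro polys.horner polys_mult_var scalars_0)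
  ultimately show ?case using normal_ordered_mult normal_ordered_add horner by simp
qed

text \<open>Both generators are linear combinations of \<open>Lam\<close> and \<open>Lams\<close>,
  and right multiplication by either preserves \<open>normal_ordered\<close>.\<close>

lemma normal_ordered_ev: "ev p \<in> normal_ordered"
proof (induction rule: ev_induct)
  case (1 c)
  then show ?case by (intro polys.const) simp
next
  case (2 x y)
  then show ?case by (rule normal_ordered_add)
next
  case (3 x)
  have "elt_U ev = sc (1/2) * (2 * elt_U ev)"
    by (simp add: mult.assoc[symmetric] sc_numeral[symmetric] sc_mult[symmetric])
  also have "2 * elt_U ev = Lam + Lams" by (simp add: Lam_def Lams_def mult_2)
  finally have U: "x * elt_U ev = sc (1/2) * (x * Lam + x * Lams)"
    by (simp only: sc_left_commute[of x] distrib_left)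
  show ?case unfolding U using 3
    by (intro normal_ordered_mult normal_ordered_add normal_ordered_mult_Lam polys_mult_var
        holo_polys_0)
next
  case (4 x)
  have "sc (- \<i>/2) * (Lam - Lams) = sc (- \<i>/2) * (sc 2 * (sc \<i> * elt_V ev))"
    by (simp add: Lam_def Lams_def sc_numeral mult_2)
  also have "\<dots> = elt_V ev"
    by (simp only: mult.assoc[symmetric] sc_mult[symmetric]) simp
  finally have "elt_V ev = sc (- \<i>/2) * (Lam + sc (- 1) * Lams)" by (simp add: sc_minus)
  then have V: "x * elt_V ev = sc (- \<i>/2) * (x * Lam + sc (- 1) * (x * Lams))"
    by (simp only: sc_left_commute[of x] distrib_left)
  show ?case unfolding V using 4
    by (intro normal_ordered_mult normal_ordered_add normal_ordered_mult_Lam polys_mult_var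
        holo_polys_0)
qed

section \<open>Structure of r-holomorphic elements\<close>

lemma r_holomorphic_fraction:
  assumes "Db x = 0"
  obtains a b where "a \<in> holo_polys" "b \<in> holo_polys" "b \<noteq> 0" "x * b = a"
proof -
  obtain p q where pq: "ev q \<noteq> 0" "x = ev p * inverse (ev q)" using fractions by blast
  then have "x * ev q = ev p" by (simp add: mult.assoc)
  from Db.fraction_ker[OF Db_holo_polys holo_polys_0 holo_polys_add assms this pq(1)
      normal_ordered_ev normal_ordered_ev] that
  show ?thesis by blast
qed

text \<open>Write \<open>x * b = a\<close> with polynomials in \<open>Lam\<close>. Both commute with
  \<open>y\<close>, so \<open>x * y * b = y * x * b\<close>, and \<open>b\<close> cancels.\<close>

lemma r_holomorphic_commute:
  assumes "Db x = 0" "Db y = 0"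
  shows "x * y = y * x"
proof -
  obtain a b where ab: "a \<in> holo_polys" "b \<in> holo_polys" "b \<noteq> 0" "x * b = a"
    using r_holomorphic_fraction assms by blast
  have "x * y * b = y * x * b"
    using ab assms holo_polys_commute by (metis mult.assoc)
  then show ?thesis using ab by simp
qed

text \<open>The kernel argument is used twice: \<open>Db\<close> reduces \<open>x\<close> to a
  fraction of polynomials in \<open>Lam\<close>, then \<open>D\<close> reduces it to a fraction of
  scalars.\<close>

lemma constant_scalar:
  assumes "D x = 0" "Db x = 0"
  obtains c where "x = sc c"
proof -
  obtain a b where ab: "a \<in> holo_polys" "b \<in> holo_polys" "b \<noteq> 0" "x * b = a"
    using r_holomorphic_fraction assms by blast
  have ker: "\<And>s. s \<in> scalars \<Longrightarrow> D s = 0" by auto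
  obtain a' b' where ab': "a' \<in> scalars" "b' \<in> scalars" "b' \<noteq> 0" "x * b' = a'"
    using D.fraction_ker[OF ker scalars_0 scalars_add assms(1) ab(4,3,1,2)] by blast
  then obtain u v where uv: "a' = sc u" "b' = sc v" by auto
  have "x * sc v = sc (u / v) * sc v"
    using ab' uv by (auto simp: sc_mult[symmetric])
  then show ?thesis using that ab' uv by auto
qed

text \<open>Step down in the degree of \<open>Y\<close> as a polynomial in \<open>Lams\<close>; since \<open>D Y\<close> has degree 0,
  the corrections do not change it.\<close>

lemma reduce_antiderivative:
  assumes "(Db ^^ Suc n) Y = 0" "Db (D Y) = 0"
  obtains Z where "Db Z = 0" "D Z = D Y"
  using assms
proof (induction n arbitrary: Y thesis)
  case (Suc n)
  \<comment> \<open>The inverse of the factor in \<open>Db.iter_mult_slice\<close>, so that the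
    subtracted term of \<open>Z\<close> cancels the top derivative of \<open>Y\<close>.\<close>
  define c where "c = inverse (of_nat (Suc n) :: 'a)"
  have c: "c = sc (inverse (of_nat (Suc n)))"
  proof -
    have "sc (inverse (of_nat (Suc n))) * of_nat (Suc n) = 1"
      by (simp only: sc_of_nat[symmetric] sc_mult[symmetric]) (simp del: of_nat_Suc)
    then show ?thesis unfolding c_def by (metis inverse_unique sc_central sc_of_nat)
  qed
  define Z where "Z = Y - c * (Db Y * Lams)"
  have Dbc: "Db c = 0" "D c = 0" by (simp_all add: c del: of_nat_Suc)
  have "(Db ^^ Suc n) (Db Y * Lams) = of_nat (Suc n) * (Db ^^ Suc n) Y"
    unfolding Db.iter_mult_slice using Suc.prems(2) by (simp add: funpow_swap1 del: of_nat_Suc)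
  then have "(Db ^^ Suc n) Z = (Db ^^ Suc n) Y - c * (of_nat (Suc n) * (Db ^^ Suc n) Y)"
    by (simp only: Z_def Db.iter_diff Db.iter_mult_const(2)[OF Dbc(1)])
  also have "\<dots> = 0"
    using of_nat_nz[of n] by (simp add: c_def mult.assoc[symmetric] del: of_nat_Suc)
  finally have 1: "(Db ^^ Suc n) Z = 0" .
  \<comment> \<open>\<open>D\<close> kills the correction, since \<open>D Lams = 0\<close> and
    \<open>D (Db Y) = Db (D Y) = 0\<close>.\<close>
  have 2: "D Z = D Y"
    using Suc.prems(3) Dbc by (simp add: Z_def D.diff D.leibniz D_Db)
  show ?case
    using Suc.IH[of Z] Suc.prems(1,3) 1 2 by metis
qed auto

text \<open>Take a denominator \<open>B\<close> of \<open>X\<close> of minimal degree in \<open>Lams\<close> and normalise its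
  leading coefficient to 1. Then \<open>D B\<close> is a denominator of smaller degree, hence 0,
  and the leading coefficient of \<open>D (X * B) = D X * B\<close> is \<open>D X\<close>.\<close>

lemma primitive_exists:
  assumes phi: "Db (D X) = 0"
  obtains Y where "Db Y = 0" "D Y = D X"
proof -
  \<comment> \<open>Nilpotency under \<open>Db\<close> stands in for being a polynomial, because
    multiplying by \<open>inverse c\<close> below may leave \<open>normal_ordered\<close>.\<close>
  define I where "I n B \<longleftrightarrow> B \<noteq> 0 \<and> (Db ^^ n) B = 0 \<and> (\<exists>m. (Db ^^ m) (X * B) = 0)" for n B
  have nil: "\<exists>n. (Db ^^ n) (ev p) = 0" for p
    using Db.polys_nilpotent[OF Db_holo_polys holo_polys_0 holo_polys_add normal_ordered_ev] .
  obtain p q where pq: "ev q \<noteq> 0" "X = ev p * inverse (ev q)" using fractions by blast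
  then have "X * ev q = ev p" by (simp add: mult.assoc)
  then have "\<exists>n B. I n B" unfolding I_def using nil pq by metis
  define n where "n = (LEAST n. \<exists>B. I n B)"
  have "\<exists>B. I n B" unfolding n_def using \<open>\<exists>n B. I n B\<close> by (rule LeastI_ex)
  then obtain B0 where B0: "I n B0" by blast
  have least: "n \<le> k" if "I k B" for k B
    unfolding n_def using that by (metis (mono_tags, lifting) Least_le)
  obtain k where k: "n = Suc k" using B0 by (cases n) (auto simp: I_def)
  define c where "c = (Db ^^ k) B0"
  have c: "c \<noteq> 0" "Db c = 0"
    using least[of k B0] B0 k by (auto simp: I_def c_def)
  have ci: "Db (inverse c) = 0" using c(2) by (rule Db_inverse)
  define B where "B = B0 * inverse c"
  have B1: "(Db ^^ k) B = 1"
    using c(1) by (simp add: B_def Db.iter_mult_const(1)[OF ci] c_def[symmetric])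
  obtain m where m: "(Db ^^ m) (X * B) = 0"
    using B0 Db.iter_mult_const(1)[OF ci] unfolding I_def B_def
    by (metis mult.assoc mult_zero_left)
  have Bn: "(Db ^^ n) B = 0" using B1 k by simp
  have DXB: "D (X * B) = D X * B + X * D B" by (rule D.leibniz)
  have "D B = 0"
  proof (rule ccontr)
    assume "D B \<noteq> 0"
    moreover have "(Db ^^ k) (D B) = 0" using B1 by (simp add: D_iter_Db[symmetric])
    \<comment> \<open>Both terms of \<open>D (X * B) - D X * B\<close> vanish after enough
      applications of \<open>Db\<close>, which commutes with \<open>D\<close> and treats
      \<open>D X\<close> as a constant.\<close>
    moreover have "(Db ^^ (m + n)) (X * D B) = 0"
    proof -
      have "(Db ^^ (m + n)) (X * B) = 0" using m by (rule Db.iter_zero_mono) simp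
      moreover have "(Db ^^ (m + n)) B = 0" using Bn by (rule Db.iter_zero_mono) simp
      moreover have "X * D B = D (X * B) - D X * B" using DXB by simp
      ultimately show ?thesis
        by (simp only: Db.iter_diff D_iter_Db[symmetric] Db.iter_mult_const(2)[OF phi]) simp
    qed
    ultimately have "I k (D B)" unfolding I_def by blast
    then show False using least k by fastforce
  qed
  \<comment> \<open>This has the right image under \<open>D\<close> but is only known to be
    nilpotent under \<open>Db\<close>; \<open>reduce_antiderivative\<close> replaces it by an
    r-holomorphic element.\<close>
  define Y where "Y = (Db ^^ k) (X * B)"
  have DY: "D Y = D X"
    using DXB \<open>D B = 0\<close> B1 by (simp add: Y_def D_iter_Db Db.iter_mult_const(2)[OF phi])
  have "(Db ^^ Suc m) Y = (Db ^^ (Suc m + k)) (X * B)" by (simp add: Y_def funpow_add)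
  also have "\<dots> = 0" using m by (rule Db.iter_zero_mono) simp
  finally show ?thesis using reduce_antiderivative[of m Y] phi DY that by metis
qed


section \<open>Conformality and harmonicity\<close>

lemma half_double: "sc (1/2) * (x + x) = x"
proof -
  have "sc (1/2) * (x + x) = sc (1/2 + 1/2) * x"
    by (simp only: sc_add distrib_left distrib_right)
  then show ?thesis by simp
qed

lemma double_eq_0: "x + x = 0 \<longleftrightarrow> x = (0::'a)"
  using half_double[of x] by auto

lemma i_i: "sc \<i> * (sc \<i> * x) = - x"
  by (simp add: sc_move sc_minus)

lemma deriv_u_eq: "deriv_u hbar ev A = D A + Db A"
  using half_double[of "deriv_u hbar ev A"]
  by (simp add: del_def delbar_def algebra_simps)

lemma deriv_v_eq: "deriv_v hbar ev A = sc \<i> * (D A - Db A)"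
proof -
  have "D A - Db A = - (sc (1/2) * (sc \<i> * deriv_v hbar ev A + sc \<i> * deriv_v hbar ev A))"
    by (simp add: del_def delbar_def algebra_simps)
  then have "D A - Db A = - (sc \<i> * deriv_v hbar ev A)" by (simp only: half_double)
  then show ?thesis by (simp add: i_i)
qed

text \<open>The Laplacian is four times \<open>D (Db A)\<close>; the 4 is written as two doublings
  so that \<open>double_eq_0\<close> applies.\<close>

lemma laplace_0_iff: "laplace hbar ev A = 0 \<longleftrightarrow> D (Db A) = 0"
proof -
  have "laplace hbar ev A = (D (Db A) + D (Db A)) + (D (Db A) + D (Db A))"
    by (simp add: laplace_def deriv_u_eq deriv_v_eq D_sc_mult Db_sc_mult D.add Db.add D.diff Db.diff
        D_Db right_diff_distrib i_i)
  then show ?thesis by (simp only: double_eq_0)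
qed

lemma vec_form_self: "vec_form ev X X = (\<Sum>i\<in>UNIV. X $ i * X $ i)"
  unfolding vec_form_def sum.distrib by (rule half_double)

text \<open>The identities are \<open>E - G = 2 (P + Q)\<close> and \<open>F = \<i> (P - Q)\<close>.
  The symmetrisation in \<open>vec_form\<close> cancels the noncommuting mixed products in
  \<open>F\<close>.\<close>

lemma conformal_iff:
  fixes X :: "'a ^ 'n"
  shows "vec_form ev (vec_u hbar ev X) (vec_u hbar ev X)
        = vec_form ev (vec_v hbar ev X) (vec_v hbar ev X) \<and>
      vec_form ev (vec_u hbar ev X) (vec_v hbar ev X) = 0
    \<longleftrightarrow> (\<Sum>i\<in>UNIV. D (X $ i) * D (X $ i)) = 0 \<and> (\<Sum>i\<in>UNIV. Db (X $ i) * Db (X $ i)) = 0"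
    (is "?E = ?G \<and> ?F = 0 \<longleftrightarrow> ?P = 0 \<and> ?Q = 0")
proof -
  have "?E - ?G = (\<Sum>i\<in>UNIV. (D (X $ i) * D (X $ i) + D (X $ i) * D (X $ i))
      + (Db (X $ i) * Db (X $ i) + Db (X $ i) * Db (X $ i)))"
    unfolding vec_form_self sum_subtractf[symmetric]
    by (rule sum.cong)
      (simp_all add: vec_u_def vec_v_def deriv_u_eq deriv_v_eq algebra_simps sc_move sc_minus)
  then have EG: "?E - ?G = (?P + ?Q) + (?P + ?Q)" by (simp add: sum.distrib)
  have "(\<Sum>i\<in>UNIV. vec_u hbar ev X $ i * vec_v hbar ev X $ i + vec_v hbar ev X $ i * vec_u hbar ev X $ i)
     = (\<Sum>i\<in>UNIV. sc \<i> * ((D (X $ i) * D (X $ i) + D (X $ i) * D (X $ i))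
      - (Db (X $ i) * Db (X $ i) + Db (X $ i) * Db (X $ i))))"
    by (rule sum.cong)
      (simp_all add: vec_u_def vec_v_def deriv_u_eq deriv_v_eq algebra_simps sc_move)
  also have "\<dots> = sc \<i> * ((?P - ?Q) + (?P - ?Q))"
    by (simp add: sum_distrib_left[symmetric] sum_subtractf sum.distrib algebra_simps)
  finally have F: "?F = sc \<i> * (?P - ?Q)"
    unfolding vec_form_def
    by (simp only: half_double sc_left_commute[of "sc (1/2)" \<i>])
  have "?E = ?G \<longleftrightarrow> ?P + ?Q = 0"
    unfolding eq_iff_diff_eq_0[of ?E ?G] EG by (rule double_eq_0)
  moreover have "?F = 0 \<longleftrightarrow> ?P = ?Q" unfolding F by simp
  moreover have "?P + ?Q = 0 \<and> ?P = ?Q \<longleftrightarrow> ?P = 0 \<and> ?Q = 0" using double_eq_0[of ?Q] by auto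
  ultimately show ?thesis by blast
qed

end

section \<open>The involution and real parts\<close>

context weyl_star_skew_field
begin

abbreviation Re :: "'a \<Rightarrow> 'a" where "Re \<equiv> re_part ev star"

lemma star_0: "star 0 = 0"
  using star_add[of 0 0] by simp

lemma star_minus: "star (- x) = - star x"
  using star_add[of x "- x"] star_0 by (simp add: eq_neg_iff_add_eq_0 add.commute)

lemma star_diff: "star (x - y) = star x - star y"
  using star_add[of x "- y"] by (simp add: star_minus)

lemma star_sum: "star (\<Sum>i\<in>A. F i) = (\<Sum>i\<in>A. star (F i))"
  by (induction A rule: infinite_finite_induct) (simp_all add: star_0 star_add)

lemma star_Lam: "star Lam = Lams"
  by (simp add: Lam_def Lams_def star_add star_mult star_U star_V star_scalar sc_minus sc_move)

lemma star_Lams: "star Lams = Lam"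
  using star_Lam star_star by metis

text \<open>The involution exchanges \<open>Lam\<close> and \<open>Lams\<close> and reverses the
  commutator, which accounts for the opposite sign in \<open>Db_eq\<close>.\<close>

lemma star_D: "star (D x) = Db (star x)"
proof -
  have "star (D x) = commutator Lam (star x) * sc (1 / (2 * of_real hbar))"
    by (simp add: D_eq commutator_def star_mult star_diff star_scalar star_Lams)
  also have "\<dots> = sc (1 / (2 * of_real hbar)) * commutator Lam (star x)"
    by (rule sc_central[symmetric])
  also have "\<dots> = Db (star x)"
    by (simp add: Db_eq commutator_def sc_minus algebra_simps)
  finally show ?thesis .
qed

lemma star_Db: "star (Db x) = D (star x)"
  using star_D star_star by metis

lemma star_Re: "star (Re P) = Re P"
  by (simp add: re_part_def star_mult star_add star_scalar star_star sc_move add.commute)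

lemma D_Re:
  assumes "Db P = 0"
  shows "D (Re P) = sc (1/2) * D P"
proof -
  have "D (star P) = 0" using assms star_Db star_0 by metis
  then show ?thesis by (simp add: re_part_def D_sc_mult D.add)
qed

text \<open>The adjoint of \<open>D z = 0\<close> is \<open>Db z = 0\<close>, so \<open>z\<close> is
  a scalar, and a hermitian scalar is real.\<close>

lemma hermitian_constant:
  assumes "star z = z" "D z = 0"
  obtains r :: real where "z = sc (of_real r)"
proof -
  have "Db z = 0" using assms star_D star_0 by metis
  then obtain c where c: "z = sc c" using constant_scalar assms by blast
  then have "cnj c = c" using assms star_scalar sc_inj by metis
  then have "c = of_real (complex.Re c)" by (simp add: complex_eq_iff)
  then show ?thesis using that c by metis
qed

text \<open>For hermitian \<open>X\<close> the second condition in \<open>conformal_iff\<close> is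
  the adjoint of the first.\<close>

lemma minimal_iff:
  fixes X :: "'a ^ 'n"
  shows "nc_minimal_surface hbar ev star X \<longleftrightarrow>
    (\<forall>i. star (X $ i) = X $ i) \<and> (\<forall>i. Db (D (X $ i)) = 0) \<and> (\<Sum>i\<in>UNIV. D (X $ i) * D (X $ i)) = 0"
proof -
  have "(\<Sum>i\<in>UNIV. Db (X $ i) * Db (X $ i)) = 0"
    if "\<forall>i. star (X $ i) = X $ i" "(\<Sum>i\<in>UNIV. D (X $ i) * D (X $ i)) = 0"
    using arg_cong[OF that(2), of star] that(1) by (simp add: star_sum star_mult star_D star_0)
  then show ?thesis
    unfolding nc_minimal_surface_def conformal_iff
    by (auto simp: hermitian_def laplace_0_iff D_Db)
qed

lemma real_part_representation:
  assumes "star X = X" "Db (D X) = 0"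
  obtains P and r :: real where "is_primitive hbar ev (D X + D X) P" "X = sc (of_real r) + Re P"
proof -
  obtain Y where Y: "Db Y = 0" "D Y = D X" using primitive_exists assms by blast
  \<comment> \<open>Doubled because taking \<open>Re\<close> halves \<open>D\<close>; then
    \<open>X - Re P\<close> is hermitian and killed by \<open>D\<close>.\<close>
  define P where "P = Y + Y"
  have P: "Db P = 0" "D P = D X + D X" using Y by (simp_all add: P_def Db.add D.add)
  have "star (X - Re P) = X - Re P" using assms by (simp add: star_diff star_Re)
  moreover have "D (X - Re P) = 0" using P by (simp add: D.diff D_Re half_double)
  ultimately obtain r :: real where "X - Re P = sc (of_real r)" using hermitian_constant by blast
  then have "X = sc (of_real r) + Re P" by (simp add: algebra_simps)
  moreover have "is_primitive hbar ev (D X + D X) P"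
    using P assms by (simp add: is_primitive_def r_holomorphic_def Db.add)
  ultimately show ?thesis using that by blast
qed

section \<open>Weierstrass data of isotropic triples\<close>

lemma weierstrass_data:
  assumes "Db a = 0" "Db b = 0" "Db c = 0" "a * a + b * b + c * c = 0" "a - sc \<i> * b \<noteq> 0"
  obtains f g where "Db f = 0" "Db g = 0" "sc (1/2) * f * (1 - g ^ 2) = a"
    "sc (\<i>/2) * f * (1 + g ^ 2) = b" "f * g = c"
proof -
  \<comment> \<open>The classical choice, \<open>g\<close> being the quotient of \<open>c\<close> by
    \<open>f\<close>.\<close>
  define f where "f = a - sc \<i> * b"
  define g where "g = inverse f * c"
  have f: "Db f = 0" "f \<noteq> 0" using assms by (simp_all add: f_def Db.diff Db_sc_mult)
  have g: "Db g = 0" using Db_inverse[OF f(1)] assms by (simp add: g_def Db.leibniz)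
  have fg: "f * g = c" using f by (simp add: g_def mult.assoc[symmetric])
  have "f * (f * g ^ 2) = f * (c * g)"
    using fg by (simp add: power2_eq_square mult.assoc[symmetric])
  also have "\<dots> = c * c"
    using fg r_holomorphic_commute[OF f(1) assms(3)] by (simp add: mult.assoc[symmetric]) (simp add: mult.assoc)
  \<comment> \<open>As \<open>a\<close> and \<open>b\<close> commute, \<open>a * a + b * b\<close>
    factors, and isotropy turns \<open>c * c\<close> into a multiple of \<open>f\<close>, which can
    be cancelled.\<close>
  also have "\<dots> = f * (- (a + sc \<i> * b))"
  proof -
    have "f * (a + sc \<i> * b) = a * a + b * b"
      using r_holomorphic_commute[OF assms(1,2)]
      by (simp add: f_def algebra_simps sc_move sc_minus)
    then have "c * c = - (f * (a + sc \<i> * b))"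
      using assms(4) by (simp only: eq_neg_iff_add_eq_0 add.commute)
    then show ?thesis by (simp only: mult_minus_right)
  qed
  finally have fgg: "f * g ^ 2 = - (a + sc \<i> * b)" using f by simp
  have "sc (1/2) * f * (1 - g ^ 2) = sc (1/2) * (f - f * g ^ 2)"
    by (simp add: algebra_simps)
  also have "\<dots> = sc (1/2) * (a + a)" unfolding fgg by (simp add: f_def)
  also have "\<dots> = a" by (rule half_double)
  finally have 1: "sc (1/2) * f * (1 - g ^ 2) = a" .
  have "sc (\<i>/2) * f * (1 + g ^ 2) = sc (1/2) * (sc \<i> * (f + f * g ^ 2))"
    by (simp add: algebra_simps sc_move)
  also have "sc \<i> * (f + f * g ^ 2) = b + b"
    unfolding fgg by (simp add: f_def right_diff_distrib distrib_left i_i)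
  also have "sc (1/2) * (b + b) = b" by (rule half_double)
  finally have 2: "sc (\<i>/2) * f * (1 + g ^ 2) = b" .
  show ?thesis using that f(1) g 1 2 fg by blast
qed

text \<open>Since \<open>f\<close> and \<open>g\<close> commute, this reduces to
  \<open>(1 - h)^2 - (1 + h)^2 + 4 h = 0\<close> for \<open>h = g^2\<close>; the minus sign is the
  square of \<open>\<i>\<close>.\<close>

lemma weierstrass_isotropic:
  assumes "Db f = 0" "Db g = 0"
  defines "a \<equiv> sc (1/2) * f * (1 - g ^ 2)" and "b \<equiv> sc (\<i>/2) * f * (1 + g ^ 2)" and "c \<equiv> f * g"
  shows "a * a + b * b + c * c = 0"
proof -
  have fg: "g * f = f * g" using r_holomorphic_commute assms by blast
  define h where "h = g ^ 2"
  have hf: "h * f = f * h" unfolding h_def power2_eq_square using fg by (metis mult.assoc)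
  have 1: "a * a = sc (1/4) * (f * f * ((1 - h) * (1 - h)))"
  proof -
    have "(1 - h) * f = f * (1 - h)" using hf by (simp add: algebra_simps)
    then have "f * (1 - h) * (f * (1 - h)) = f * f * ((1 - h) * (1 - h))" by (metis mult.assoc)
    then show ?thesis unfolding a_def h_def[symmetric] by (simp add: mult.assoc sc_move)
  qed
  have 2: "b * b = - (sc (1/4) * (f * f * ((1 + h) * (1 + h))))"
  proof -
    have "(1 + h) * f = f * (1 + h)" using hf by (simp add: algebra_simps)
    then have "f * (1 + h) * (f * (1 + h)) = f * f * ((1 + h) * (1 + h))" by (metis mult.assoc)
    then show ?thesis unfolding b_def h_def[symmetric] by (simp add: mult.assoc sc_move sc_minus)
  qed
  have 3: "c * c = f * f * h"
    unfolding c_def h_def power2_eq_square using fg by (metis mult.assoc)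
  have "(1 - h) * (1 - h) - (1 + h) * (1 + h) = - (4 * h)"
  proof -
    have "(4::'a) = 1 + 1 + 1 + 1" by simp
    then show ?thesis by (simp only: distrib_right) (simp add: algebra_simps)
  qed
  then have "a * a + b * b = - (sc (1/4) * (f * f * (4 * h)))"
    unfolding 1 2 by (simp add: right_diff_distrib[symmetric])
  also have "\<dots> = - (f * f * h)" by (simp add: sc_numeral[symmetric] sc_move mult.assoc)
  finally show ?thesis using 3 by simp
qed

end

theorem theorem2p9:
  fixes hbar :: real and ev :: "free_alg \<Rightarrow> 'a::division_ring" and star :: "'a \<Rightarrow> 'a"
  assumes "weyl_star_skew_field hbar ev star"
  shows
    "(\<forall>X :: 'a ^ 3.
        nc_minimal_surface hbar ev star X \<longrightarrow>
        del hbar ev (X $ 1 - scalar ev \<i> * X $ 2) \<noteq> 0 \<longrightarrow>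
        (\<exists>f g. \<exists>x1 x2 x3 :: real. \<exists>P1 P2 P3.
           r_holomorphic hbar ev f \<and> r_holomorphic hbar ev g \<and>
           integrable_elt hbar ev (scalar ev (1/2) * f * (1 - g ^ 2)) \<and>
           integrable_elt hbar ev (scalar ev (\<i>/2) * f * (1 + g ^ 2)) \<and>
           integrable_elt hbar ev (f * g) \<and>
           is_primitive hbar ev (scalar ev (1/2) * f * (1 - g ^ 2)) P1 \<and>
           is_primitive hbar ev (scalar ev (\<i>/2) * f * (1 + g ^ 2)) P2 \<and>
           is_primitive hbar ev (f * g) P3 \<and>
           X $ 1 = scalar ev (of_real x1) + re_part ev star P1 \<and>
           X $ 2 = scalar ev (of_real x2) + re_part ev star P2 \<and>
           X $ 3 = scalar ev (of_real x3) + re_part ev star P3))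
     \<and>
     (\<forall>f g. \<forall>x1 x2 x3 :: real. \<forall>P1 P2 P3. \<forall>X :: 'a ^ 3.
        r_holomorphic hbar ev f \<longrightarrow> r_holomorphic hbar ev g \<longrightarrow>
        integrable_elt hbar ev (f * (1 - g ^ 2)) \<longrightarrow>
        integrable_elt hbar ev (f * (1 + g ^ 2)) \<longrightarrow>
        integrable_elt hbar ev (f * g) \<longrightarrow>
        is_primitive hbar ev (scalar ev (1/2) * f * (1 - g ^ 2)) P1 \<longrightarrow>
        is_primitive hbar ev (scalar ev (\<i>/2) * f * (1 + g ^ 2)) P2 \<longrightarrow>
        is_primitive hbar ev (f * g) P3 \<longrightarrow>
        X $ 1 = scalar ev (of_real x1) + re_part ev star P1 \<longrightarrow>
        X $ 2 = scalar ev (of_real x2) + re_part ev star P2 \<longrightarrow>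
        X $ 3 = scalar ev (of_real x3) + re_part ev star P3 \<longrightarrow>
        nc_minimal_surface hbar ev star X)"
proof -
  interpret weyl_star_skew_field hbar ev star by (rule assms)
  show ?thesis
  proof (intro conjI allI impI)
    fix X :: "'a ^ 3"
    assume "nc_minimal_surface hbar ev star X" and nz: "D (X $ 1 - sc \<i> * X $ 2) \<noteq> 0"
    then have herm: "\<And>i. star (X $ i) = X $ i" and harm: "\<And>i. Db (D (X $ i)) = 0"
      and iso: "D (X $ 1) * D (X $ 1) + D (X $ 2) * D (X $ 2) + D (X $ 3) * D (X $ 3) = 0"
      unfolding minimal_iff by (simp_all add: sum_3)
    \<comment> \<open>The integrands must be twice \<open>D (X $ i)\<close>, again because
      \<open>Re\<close> halves \<open>D\<close>.\<close>
    define p where "p i = D (X $ i) + D (X $ i)" for i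
    have p: "Db (p i) = 0" for i using harm by (simp add: p_def Db.add)
    have p_square: "p i * p i = sc 4 * (D (X $ i) * D (X $ i))" for i
    proof -
      have "(4::'a) = 1 + 1 + 1 + 1" by simp
      then show ?thesis unfolding p_def sc_numeral by (simp only: distrib_right) (simp add: algebra_simps)
    qed
    have "p 1 * p 1 + p 2 * p 2 + p 3 * p 3 = 0"
      unfolding p_square using iso by (simp add: distrib_left[symmetric])
    moreover have "p 1 - sc \<i> * p 2 \<noteq> 0"
    proof -
      define y where "y = D (X $ 1 - sc \<i> * X $ 2)"
      have "p 1 - sc \<i> * p 2 = y + y"
        by (simp add: p_def y_def D.diff D_sc_mult algebra_simps)
      then show ?thesis using nz double_eq_0[of y] by (simp add: y_def)
    qed
    ultimately obtain f g where fg: "Db f = 0" "Db g = 0" "sc (1/2) * f * (1 - g ^ 2) = p 1"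
      "sc (\<i>/2) * f * (1 + g ^ 2) = p 2" "f * g = p 3"
      using weierstrass_data[OF p p p] by metis
    have "\<exists>P (r::real). is_primitive hbar ev (p i) P \<and> X $ i = sc (of_real r) + Re P" for i
      using real_part_representation[OF herm harm] unfolding p_def by metis
    then show "\<exists>f g. \<exists>x1 x2 x3 :: real. \<exists>P1 P2 P3.
           r_holomorphic hbar ev f \<and> r_holomorphic hbar ev g \<and>
           integrable_elt hbar ev (scalar ev (1/2) * f * (1 - g ^ 2)) \<and>
           integrable_elt hbar ev (scalar ev (\<i>/2) * f * (1 + g ^ 2)) \<and>
           integrable_elt hbar ev (f * g) \<and>
           is_primitive hbar ev (scalar ev (1/2) * f * (1 - g ^ 2)) P1 \<and>
           is_primitive hbar ev (scalar ev (\<i>/2) * f * (1 + g ^ 2)) P2 \<and>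
           is_primitive hbar ev (f * g) P3 \<and>
           X $ 1 = scalar ev (of_real x1) + re_part ev star P1 \<and>
           X $ 2 = scalar ev (of_real x2) + re_part ev star P2 \<and>
           X $ 3 = scalar ev (of_real x3) + re_part ev star P3"
      using fg p unfolding integrable_elt_def r_holomorphic_def by metis
  next
    fix f g P1 P2 P3 and x1 x2 x3 :: real and X :: "'a ^ 3"
    assume hol: "r_holomorphic hbar ev f" "r_holomorphic hbar ev g"
      and P1: "is_primitive hbar ev (sc (1/2) * f * (1 - g ^ 2)) P1"
      and P2: "is_primitive hbar ev (sc (\<i>/2) * f * (1 + g ^ 2)) P2"
      and P3: "is_primitive hbar ev (f * g) P3"
      and X: "X $ 1 = sc (of_real x1) + Re P1" "X $ 2 = sc (of_real x2) + Re P2"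
        "X $ 3 = sc (of_real x3) + Re P3"
    have herm: "star (sc (of_real r) + Re P) = sc (of_real r) + Re P" for r P
      by (simp add: star_add star_scalar star_Re)
    have DX: "D (sc (of_real r) + Re P) = sc (1/2) * a" and harm: "Db (sc (1/2) * a) = 0"
      if "is_primitive hbar ev a P" for a P r
      using that by (simp_all add: is_primitive_def r_holomorphic_def D.add D_Re Db_sc_mult)
    \<comment> \<open>Each \<open>D (X $ i)\<close> is half an integrand, so 1/4 factors out of the
      sum of squares and leaves \<open>weierstrass_isotropic\<close>.\<close>
    have sq: "sc (1/2) * a * (sc (1/2) * a) = sc (1/4) * (a * a)" for a
      by (simp add: mult.assoc sc_move)
    note iso = weierstrass_isotropic[OF hol[unfolded r_holomorphic_def]]
    show "nc_minimal_surface hbar ev star X"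
      unfolding minimal_iff forall_3 sum_3 X DX[OF P1] DX[OF P2] DX[OF P3] sq distrib_left[symmetric] iso
      using herm harm[OF P1] harm[OF P2] harm[OF P3] by simp
  qed
qed

end
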